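(* For every $n\in\mathbb{N}$, \[ \mathcal{M}^{(1/2)}(n)=\min_{1\le s\le t\le n}\mathcal{M}^{(1/2)}(n,s,t)=\Bigl\lfloor\frac{15n^2+72}{76}\Bigr\rfloor+\begin{cases}1,& n\equiv 18 \text{ or } n\equiv 20\pmod{38},\\ -1,& n\equiv 19\pmod{38},\\ 0,&\text{otherwise}.\end{cases} \]
   Context: For real $a>0$ and integers $1\le s\le t\le n$, $\mathcal{M}^{(a)}(n,s,t)$ is the number of ordered triples $T=(x,y,x+\lfloor ay\rfloor)\in\{1,\dots,n\}^3$ such that $T\in(\{1,\dots,s\}\cup\{t+1,\dots,n\})^3$ or $T\in\{s+1,\dots,t\}^3$ (monochromatic generalized Schur triples under the coloring $R^sB^{t-s}R^{n-t}$). For $a=1/2$ the triples are $(x,y,x+\lfloor y/2\rfloor)$. *)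

theory Defs
  imports Complex_Main
begin

definition red_set :: "nat \<Rightarrow> nat \<Rightarrow> nat \<Rightarrow> nat set" where
  "red_set n s t = {1..s} \<union> {t+1..n}"

definition blue_set :: "nat \<Rightarrow> nat \<Rightarrow> nat set" where
  "blue_set s t = {s+1..t}"

definition schur_triples :: "real \<Rightarrow> nat \<Rightarrow> (nat \<times> nat \<times> nat) set" where
  "schur_triples a n =
     {(x, y, z). x \<in> {1..n} \<and> y \<in> {1..n} \<and> z \<in> {1..n} \<and>
                 int z = int x + \<lfloor>a * real y\<rfloor>}"

definition M_count :: "real \<Rightarrow> nat \<Rightarrow> nat \<Rightarrow> nat \<Rightarrow> nat" where
  "M_count a n s t = card {T \<in> schur_triples a n.
      (case T of (x, y, z) \<Rightarrow>
         (x \<in> red_set n s t \<and> y \<in> red_set n s t \<and> z \<in> red_set n s t) \<or>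
         (x \<in> blue_set s t \<and> y \<in> blue_set s t \<and> z \<in> blue_set s t))}"

end

theory Submission
  imports Defs
begin

text \<open>Summing over y turns the count into seven sums of truncated linear functions of y div 2. In the
  region n \<le> 2 t, 3 t \<le> 2 n, 2 s \<le> t, 2 (t - s) \<le> n all truncations can be evaluated, and the count M
  satisfies
    304 M = 19 (8 t - 5 s - 4 n)^2 + (19 s - 4 n)^2 + 60 n^2 - 76 (n mod 2) + 76 (s mod 2).
  The substitution (n, s, t) = (38 q + r, 8 q + a, 24 q + b) changes both 4 M and 4 times the claimed
  minimum by 4 (285 q^2 + 15 q r), which reduces the claim to the residues r < 38; for each of them the
  two squares leave only finitely many (a, b). Outside that region, discarding suitable truncated
  terms leaves quadratic lower bounds whose minimum exceeds 15/76 n^2 by a positive multiple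
  of n^2, enough for n \<ge> 24. The remaining n are enumerated.\<close>

section \<open>Counting triples row by row, one row for each y\<close>

definition row_count :: "nat \<Rightarrow> nat \<Rightarrow> nat \<Rightarrow> nat \<Rightarrow> nat" where
  "row_count n s t y =
     (if y \<le> s \<or> t < y
      then (s - y div 2) + (n - t - y div 2) + (min s (n - y div 2) - (t - y div 2))
      else t - s - y div 2)"

text \<open>Put h = y div 2. For red y, since x \<le> x + h, the pair (x, x + h) lies in the left
  red block, in the right one, or has x in the left and x + h in the right. These give three
  disjoint intervals of x, and truncated subtraction counts an empty interval as 0.\<close>

lemma card_row_count:
  assumes "s \<le> t" "t \<le> n" "1 \<le> y" "y \<le> n"
  shows "card {x. 1 \<le> x \<and> x + y div 2 \<le> n \<and>
      (x \<in> red_set n s t \<and> y \<in> red_set n s t \<and> x + y div 2 \<in> red_set n s t \<or>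
       x \<in> blue_set s t \<and> y \<in> blue_set s t \<and> x + y div 2 \<in> blue_set s t)} = row_count n s t y"
    (is "card ?X = _")
proof (cases "y \<le> s \<or> t < y")
  case True
  let ?h = "y div 2"
  have y: "y \<in> red_set n s t" "y \<notin> blue_set s t"
    using True assms by (auto simp: red_set_def blue_set_def)
  have "1 \<le> x \<and> x + h \<le> n \<and> x \<in> red_set n s t \<and> x + h \<in> red_set n s t \<longleftrightarrow>
      1 \<le> x \<and> x \<le> s - h \<or> t < x \<and> x \<le> n - h \<or> t - h < x \<and> x \<le> s \<and> x \<le> n - h" for x h
    unfolding red_set_def Un_iff atLeastAtMost_iff using assms by linarith
  then have "?X = {1..s - ?h} \<union> {t+1..n - ?h} \<union> {Suc (t - ?h)..min s (n - ?h)}"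
    using y by (intro set_eqI) (simp add: Suc_le_eq)
  also have "card \<dots> = card ({1..s - ?h} \<union> {t+1..n - ?h}) + card {Suc (t - ?h)..min s (n - ?h)}"
    using assms by (intro card_Un_disjoint) auto
  also have "card ({1..s - ?h} \<union> {t+1..n - ?h}) = card {1..s - ?h} + card {t+1..n - ?h}"
    using assms by (intro card_Un_disjoint) auto
  finally show ?thesis using True by (simp add: row_count_def add.commute)
next
  case False
  have "?X = {s+1..t - y div 2}"
    using False assms by (intro set_eqI) (simp add: red_set_def blue_set_def, linarith)
  then show ?thesis using False by (simp add: row_count_def)
qed

lemma M_count_rows:
  assumes "s \<le> t" "t \<le> n"
  shows "M_count (1/2) n s t = (\<Sum>y\<in>{0<..n}. row_count n s t y)"
proof -
  define mono where "mono = (\<lambda>x y z.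
      (x \<in> red_set n s t \<and> y \<in> red_set n s t \<and> z \<in> red_set n s t) \<or>
      (x \<in> blue_set s t \<and> y \<in> blue_set s t \<and> z \<in> blue_set s t))"
  define X where "X = (\<lambda>y. {x. 1 \<le> x \<and> x + y div 2 \<le> n \<and> mono x y (x + y div 2)})"
  have half: "\<lfloor>1/2 * real y\<rfloor> = int (y div 2)" for y
    using floor_divide_of_nat_eq[of y 2] by simp
  have triple: "(x, y, z) \<in> schur_triples (1/2) n \<longleftrightarrow>
      1 \<le> x \<and> 1 \<le> y \<and> y \<le> n \<and> z \<le> n \<and> z = x + y div 2" for x y z
    unfolding schur_triples_def half by auto
  \<comment> \<open>The third entry is determined by the other two, so triples correspond
    bijectively to pairs (y, x) fibred over y.\<close>
  have "{T \<in> schur_triples (1/2) n. case T of (x, y, z) \<Rightarrow> mono x y z}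
      = (\<lambda>(y, x). (x, y, x + y div 2)) ` (SIGMA y:{0<..n}. X y)" (is "?L = ?f ` ?R")
  proof (intro equalityI subsetI)
    fix T assume T: "T \<in> ?L"
    obtain x y z where xyz: "T = (x, y, z)" by (cases T)
    show "T \<in> ?f ` ?R"
      using T xyz triple by (intro image_eqI[of _ _ "(y, x)"]) (auto simp: X_def)
  next
    fix T assume "T \<in> ?f ` ?R"
    then show "T \<in> ?L"
      using triple by (auto simp: X_def)
  qed
  moreover have "inj_on ?f ?R" by (auto simp: inj_on_def)
  ultimately have "M_count (1/2) n s t = card ?R"
    unfolding M_count_def mono_def by (simp only: card_image)
  also have "\<dots> = (\<Sum>y\<in>{0<..n}. card (X y))"
  proof (rule card_SigmaI)
    show "\<forall>y\<in>{0<..n}. finite (X y)"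
      by (intro ballI, rule finite_subset[of _ "{..n}"]) (auto simp: X_def)
  qed simp
  also have "\<dots> = (\<Sum>y\<in>{0<..n}. row_count n s t y)"
    unfolding X_def mono_def using assms by (intro sum.cong[OF refl] card_row_count) auto
  finally show ?thesis .
qed

section \<open>Sums of y div 2 and quarter squares\<close>

definition quarter_sq :: "nat \<Rightarrow> real" where "quarter_sq m = real (m\<^sup>2 div 4)"

text \<open>Modulo 4 a square equals the parity of its root.\<close>

lemma quarter_sq_eq: "4 * quarter_sq m = (real m)\<^sup>2 - real (m mod 2)"
proof -
  have "m\<^sup>2 mod 4 = m mod 2"
  proof (cases "even m")
    case True
    then obtain k where "m = 2 * k" by blast
    then show ?thesis by (simp add: power2_eq_square)
  next
    case False
    then obtain k where "m = 2 * k + 1" by (auto elim: oddE)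
    then have "m\<^sup>2 = 4 * (k\<^sup>2 + k) + 1" by (simp add: power2_eq_square algebra_simps)
    moreover have "m mod 2 = 1" using False by presburger
    moreover have "(4 * u + 1) mod 4 = 1" for u :: nat by presburger
    ultimately show ?thesis by simp
  qed
  then have "4 * (m\<^sup>2 div 4) + m mod 2 = m\<^sup>2"
    using div_mult_mod_eq[of "m\<^sup>2" 4] by linarith
  then have "real (4 * (m\<^sup>2 div 4) + m mod 2) = real (m\<^sup>2)"
    by (rule arg_cong)
  then show ?thesis by (simp add: quarter_sq_def)
qed

lemma quarter_sq_bounds: "4 * quarter_sq m \<le> (real m)\<^sup>2" "(real m)\<^sup>2 \<le> 4 * quarter_sq m + 1"
proof -
  have "real (m mod 2) \<le> 1" by simp
  then show "4 * quarter_sq m \<le> (real m)\<^sup>2" "(real m)\<^sup>2 \<le> 4 * quarter_sq m + 1"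
    using quarter_sq_eq[of m] by simp_all
qed

text \<open>Makes \<open>quarter_sq\<close> the summatory function of y div 2, so that
  \<open>sum_half\<close> telescopes.\<close>

lemma quarter_sq_Suc: "quarter_sq (Suc m) = quarter_sq m + real (Suc m div 2)"
proof -
  have "(Suc m)\<^sup>2 div 4 = m\<^sup>2 div 4 + Suc m div 2"
  proof (cases "even m")
    case True
    then obtain k where "m = 2 * k" by blast
    then show ?thesis by (simp add: power2_eq_square)
  next
    case False
    then obtain k where k: "m = 2 * k + 1" by (auto elim: oddE)
    then have "m\<^sup>2 = 4 * (k\<^sup>2 + k) + 1" "(Suc m)\<^sup>2 = 4 * (k\<^sup>2 + 2 * k + 1)" "Suc m div 2 = k + 1"
      by (simp_all add: power2_eq_square algebra_simps)
    moreover have "(4 * u + 1) div 4 = u" "4 * u div 4 = u" for u :: nat by presburger+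
    ultimately show ?thesis by simp
  qed
  then show ?thesis by (simp add: quarter_sq_def)
qed

lemma quarter_sq_even: "quarter_sq (2 * m) = (real m)\<^sup>2"
  by (simp add: quarter_sq_def power_mult_distrib)

lemma sum_half:
  assumes "p \<le> q"
  shows "(\<Sum>y\<in>{p<..q}. real (y div 2)) = quarter_sq q - quarter_sq p"
  using assms
proof (induction q rule: dec_induct)
  case (step q)
  then have "{p<..Suc q} = insert (Suc q) {p<..q}" by auto
  then show ?case using step by (simp add: quarter_sq_Suc)
qed simp

section \<open>Sums of truncated linear functions of y div 2\<close>

definition gap_sum :: "nat \<Rightarrow> nat \<Rightarrow> nat \<Rightarrow> real" where
  "gap_sum a p q = (\<Sum>y\<in>{p<..q}. real (a - y div 2))"

definition excess_sum :: "nat \<Rightarrow> nat \<Rightarrow> nat \<Rightarrow> real" where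
  "excess_sum d p q = (\<Sum>y\<in>{p<..q}. real (y div 2 - d))"

lemma gap_sum_nonneg: "0 \<le> gap_sum a p q"
  and excess_sum_nonneg: "0 \<le> excess_sum d p q"
  by (simp_all add: gap_sum_def excess_sum_def sum_nonneg)

text \<open>Truncation at 0 can only raise a term, so the sum without truncation is a lower
  bound.\<close>

lemma gap_sum_ge:
  assumes "p \<le> q"
  shows "real a * (real q - real p) - (quarter_sq q - quarter_sq p) \<le> gap_sum a p q"
proof -
  have "(\<Sum>y\<in>{p<..q}. real a - real (y div 2)) \<le> gap_sum a p q"
    unfolding gap_sum_def by (intro sum_mono) linarith
  then show ?thesis
    using assms by (simp add: sum_subtractf sum_half algebra_simps of_nat_diff)
qed

text \<open>The bound q \<le> 2 a + 1 says q div 2 \<le> a, so no term is truncated.\<close>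

lemma gap_sum_eq:
  assumes "p \<le> q" "q \<le> 2 * a + 1"
  shows "gap_sum a p q = real a * (real q - real p) - (quarter_sq q - quarter_sq p)"
proof -
  have "gap_sum a p q = (\<Sum>y\<in>{p<..q}. real a - real (y div 2))"
    unfolding gap_sum_def using assms by (intro sum.cong) (auto simp: of_nat_diff)
  then show ?thesis
    using assms by (simp add: sum_subtractf sum_half algebra_simps of_nat_diff)
qed

lemma gap_sum_cut:
  assumes "2 * a \<le> q"
  shows "gap_sum a p q = gap_sum a p (2 * a)"
  unfolding gap_sum_def using assms by (intro sum.mono_neutral_right) auto

lemma excess_sum_eq:
  assumes "p \<le> q" "2 * d \<le> p + 1"
  shows "excess_sum d p q = quarter_sq q - quarter_sq p - real d * (real q - real p)"
proof -
  have "excess_sum d p q = (\<Sum>y\<in>{p<..q}. real (y div 2) - real d)"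
    unfolding excess_sum_def using assms by (intro sum.cong) (auto simp: of_nat_diff)
  then show ?thesis
    using assms by (simp add: sum_subtractf sum_half algebra_simps of_nat_diff)
qed

lemma excess_sum_cut:
  assumes "p \<le> 2 * d"
  shows "excess_sum d p q = excess_sum d (2 * d) q"
  unfolding excess_sum_def using assms by (intro sum.mono_neutral_right) auto

text \<open>The left-hand side is concave in c; its maximum over the admissible c, attained at n - 2 d clipped
  to that interval, is up to rounding 4 times the sum.\<close>
lemma excess_sum_tangent:
  assumes "t \<le> n" "0 \<le> c" "c \<le> real n - real t"
  shows "c * (2 * real n - 4 * real d - c) \<le> 4 * excess_sum d t n + 1"
proof -
  consider "n < 2 * d" | "2 * d \<le> t" | "t \<le> 2 * d" "2 * d \<le> n" by linarith
  then show ?thesis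
  proof cases
    case 1
    then have "c * (2 * real n - 4 * real d - c) \<le> 0"
      using assms by (intro mult_nonneg_nonpos) auto
    then show ?thesis using excess_sum_nonneg[of d t n] by linarith
  next
    case 2
    \<comment> \<open>Up to rounding, this product is 4 times the sum minus the left-hand side of
      the claim; the square in the next case has the same role.\<close>
    have "0 \<le> (real n - real t - c) * (real t - 2 * real d + real n - 2 * real d - c)"
      using 2 assms by (intro mult_nonneg_nonneg) auto
    moreover have "excess_sum d t n = quarter_sq n - quarter_sq t - real d * (real n - real t)"
      using 2 assms by (intro excess_sum_eq) auto
    ultimately show ?thesis using quarter_sq_bounds[of n] quarter_sq_bounds[of t]
      by (simp add: algebra_simps power2_eq_square)
  next
    case 3
    have "excess_sum d t n = quarter_sq n - (real d)\<^sup>2 - real d * (real n - 2 * real d)"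
      using 3 by (subst excess_sum_cut, simp, subst excess_sum_eq) (auto simp: quarter_sq_even)
    moreover have "0 \<le> (real n - 2 * real d - c)\<^sup>2" by simp
    ultimately show ?thesis using quarter_sq_bounds[of n]
      by (simp add: algebra_simps power2_eq_square)
  qed
qed

section \<open>Decomposition of the count into seven sums\<close>

definition cross_sum :: "nat \<Rightarrow> nat \<Rightarrow> nat \<Rightarrow> nat \<Rightarrow> nat \<Rightarrow> real" where
  "cross_sum n s t p q = (\<Sum>y\<in>{p<..q}. real (min s (n - y div 2) - (t - y div 2)))"

text \<open>Cutting the range of y at s and t makes the color of y constant on each piece.\<close>

lemma M_count_split:
  assumes "s \<le> t" "t \<le> n"
  shows "real (M_count (1/2) n s t) =
    gap_sum s 0 s + gap_sum (n - t) 0 s + cross_sum n s t 0 s + gap_sum (t - s) s t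
    + gap_sum s t n + gap_sum (n - t) t n + cross_sum n s t t n"
proof -
  have "{0<..n} = {0<..s} \<union> {s<..t} \<union> {t<..n}" using assms by auto
  then have "(\<Sum>y\<in>{0<..n}. real (row_count n s t y)) = (\<Sum>y\<in>{0<..s} \<union> {s<..t}. real (row_count n s t y))
       + (\<Sum>y\<in>{t<..n}. real (row_count n s t y))"
    using assms by (simp only:) (subst sum.union_disjoint, auto)
  also have "(\<Sum>y\<in>{0<..s} \<union> {s<..t}. real (row_count n s t y)) =
      (\<Sum>y\<in>{0<..s}. real (row_count n s t y)) + (\<Sum>y\<in>{s<..t}. real (row_count n s t y))"
    using assms by (subst sum.union_disjoint) auto
  also have "(\<Sum>y\<in>{0<..s}. real (row_count n s t y))
      = gap_sum s 0 s + gap_sum (n - t) 0 s + cross_sum n s t 0 s"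
    unfolding gap_sum_def cross_sum_def sum.distrib[symmetric]
    by (intro sum.cong) (auto simp: row_count_def)
  also have "(\<Sum>y\<in>{s<..t}. real (row_count n s t y)) = gap_sum (t - s) s t"
    unfolding gap_sum_def by (intro sum.cong) (auto simp: row_count_def)
  also have "(\<Sum>y\<in>{t<..n}. real (row_count n s t y))
      = gap_sum s t n + gap_sum (n - t) t n + cross_sum n s t t n"
    unfolding gap_sum_def cross_sum_def sum.distrib[symmetric]
    using assms by (intro sum.cong) (auto simp: row_count_def)
  finally show ?thesis using assms by (simp add: M_count_rows)
qed

lemma cross_sum_nonneg: "0 \<le> cross_sum n s t p q"
  by (simp add: cross_sum_def sum_nonneg)

text \<open>Since y div 2 \<le> n/2, it is at most t and at most n - s; the minimum is then s and
  the inner difference is not truncated.\<close>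

lemma cross_sum_high:
  assumes "2 * s \<le> n" "s \<le> t" "n \<le> 2 * t"
  shows "cross_sum n s t t n = excess_sum (t - s) t n"
  unfolding cross_sum_def excess_sum_def
proof (rule sum.cong[OF refl])
  fix y assume y: "y \<in> {t<..n}"
  then have "s \<le> n - y div 2" "y div 2 \<le> t" using assms by auto
  then show "real (min s (n - y div 2) - (t - y div 2)) = real (y div 2 - (t - s))"
    using assms by (simp add: min_def)
qed

text \<open>All sums are bounded by \<open>gap_sum_ge\<close>. In the first inequality
  \<open>quarter_sq s\<close> cancels and only \<open>quarter_sq t\<close> \<le> t^2/4 is
  rounded.\<close>

lemma outer_sums_ge:
  assumes "s \<le> t" "t \<le> n"
  shows "(real s)\<^sup>2 + (real t - real s)\<^sup>2 - (real t)\<^sup>2 / 4 \<le> gap_sum s 0 s + gap_sum (t - s) s t"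
    and "7/4 * (real s)\<^sup>2 + real n * real s - 3 * real t * real s + 3/4 * (real t)\<^sup>2
           \<le> gap_sum s 0 s + gap_sum (n - t) 0 s + gap_sum (t - s) s t"
proof -
  have H0: "quarter_sq 0 = 0" by (simp add: quarter_sq_def)
  have 1: "(real s)\<^sup>2 - quarter_sq s \<le> gap_sum s 0 s"
    using gap_sum_ge[of 0 s s] H0 by (simp add: power2_eq_square)
  have 2: "(real t - real s)\<^sup>2 - (quarter_sq t - quarter_sq s) \<le> gap_sum (t - s) s t"
    using gap_sum_ge[of s t "t - s"] assms by (simp add: power2_eq_square of_nat_diff)
  have 3: "(real n - real t) * real s - quarter_sq s \<le> gap_sum (n - t) 0 s"
    using gap_sum_ge[of 0 s "n - t"] H0 assms by (simp add: of_nat_diff)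
  show "(real s)\<^sup>2 + (real t - real s)\<^sup>2 - (real t)\<^sup>2 / 4 \<le> gap_sum s 0 s + gap_sum (t - s) s t"
    using 1 2 quarter_sq_bounds[of t] by linarith
  show "7/4 * (real s)\<^sup>2 + real n * real s - 3 * real t * real s + 3/4 * (real t)\<^sup>2
           \<le> gap_sum s 0 s + gap_sum (n - t) 0 s + gap_sum (t - s) s t"
    using 1 2 3 quarter_sq_bounds[of t] quarter_sq_bounds[of s] by (simp add: power2_eq_square algebra_simps)
qed

section \<open>The exact quadratic formula in the central region\<close>

lemma high_gap_sum:
  assumes "t \<le> n" "n \<le> 2 * t" "3 * t \<le> 2 * n"
  shows "gap_sum (n - t) t n = (real n - real t)\<^sup>2 - (real n - real t) * real t + quarter_sq t"
proof -
  have "gap_sum (n - t) t n = gap_sum (n - t) t (2 * (n - t))"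
    using assms by (intro gap_sum_cut) auto
  also have "\<dots> = real (n - t) * (real (2 * (n - t)) - real t) - (quarter_sq (2 * (n - t)) - quarter_sq t)"
    using assms by (intro gap_sum_eq) auto
  finally show ?thesis
    unfolding quarter_sq_even using assms by (simp add: of_nat_diff power2_eq_square algebra_simps)
qed

text \<open>The hypotheses place the truncation points: t \<le> 2 (n - t) \<le> n for C, and t \<le>
  2 (t - s) \<le> n for D and E. The terms \<open>quarter_sq t\<close> of C and E cancel, so only
  the parities of n and s remain.\<close>

lemma M_count_central:
  assumes "n \<le> 2 * t" "3 * t \<le> 2 * n" "2 * s \<le> t" "2 * t \<le> n + 2 * s"
  shows "4 * int (M_count (1/2) n s t) =
    11 * (int s)\<^sup>2 + 8 * int n * int s - 20 * int t * int s + 16 * (int t)\<^sup>2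
      - 16 * int n * int t + 5 * (int n)\<^sup>2 - int n mod 2 + int s mod 2"
proof -
  have le: "s \<le> t" "t \<le> n" using assms by auto
  have H0: "quarter_sq 0 = 0" by (simp add: quarter_sq_def)
  have A: "gap_sum s 0 s = (real s)\<^sup>2 - quarter_sq s"
    using H0 by (subst gap_sum_eq) (auto simp: power2_eq_square)
  have B: "gap_sum (n - t) 0 s = (real n - real t) * real s - quarter_sq s"
    using H0 le assms by (subst gap_sum_eq) (auto simp: of_nat_diff)
  have E: "gap_sum (t - s) s t = (real t - real s)\<^sup>2 - (quarter_sq t - quarter_sq s)"
    using le assms by (subst gap_sum_eq) (auto simp: of_nat_diff power2_eq_square)
  note C = high_gap_sum[OF le(2) assms(1,2)]
  have D: "cross_sum n s t t n = quarter_sq n + (real t - real s)\<^sup>2 - real n * (real t - real s)"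
  proof -
    have "cross_sum n s t t n = excess_sum (t - s) (2 * (t - s)) n"
      using assms le by (subst cross_sum_high) (auto intro!: excess_sum_cut)
    also have "\<dots> = quarter_sq n - quarter_sq (2 * (t - s)) - real (t - s) * (real n - real (2 * (t - s)))"
      using assms le by (intro excess_sum_eq) auto
    finally show ?thesis
      unfolding quarter_sq_even of_nat_mult of_nat_diff[OF le(1)] by (simp add: power2_eq_square algebra_simps)
  qed
  \<comment> \<open>Both follow from 2 s \<le> t: y > t gives y div 2 \<ge> s, and y \<le> s gives s
    + y div 2 \<le> t.\<close>
  have zero: "gap_sum s t n = 0" "cross_sum n s t 0 s = 0"
    unfolding gap_sum_def cross_sum_def using assms by (auto intro!: sum.neutral)
  have parity: "real_of_int (int k mod 2) = real (k mod 2)" for k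
    by (metis of_int_of_nat_eq of_nat_mod of_nat_numeral)
  have "4 * real (M_count (1/2) n s t) =
    11 * (real s)\<^sup>2 + 8 * real n * real s - 20 * real t * real s + 16 * (real t)\<^sup>2
      - 16 * real n * real t + 5 * (real n)\<^sup>2 - real (n mod 2) + real (s mod 2)"
    unfolding M_count_split[OF le] A B C D E zero
    using quarter_sq_eq[of n] quarter_sq_eq[of s] by (simp add: power2_eq_square algebra_simps)
  also have "\<dots> = real_of_int (11 * (int s)\<^sup>2 + 8 * int n * int s - 20 * int t * int s + 16 * (int t)\<^sup>2
      - 16 * int n * int t + 5 * (int n)\<^sup>2 - int n mod 2 + int s mod 2)"
    by (simp add: parity)
  finally have "real_of_int (4 * int (M_count (1/2) n s t)) = real_of_int (11 * (int s)\<^sup>2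
      + 8 * int n * int s - 20 * int t * int s + 16 * (int t)\<^sup>2
      - 16 * int n * int t + 5 * (int n)\<^sup>2 - int n mod 2 + int s mod 2)"
    by simp
  then show ?thesis by (rule of_int_eq_iff[THEN iffD1])
qed

section \<open>Quadratic lower bounds outside the central region\<close>

lemma M_count_outer:
  assumes le: "s \<le> t" "t \<le> n" and n: "24 \<le> n"
    and outer: "\<not> (n \<le> 2 * t \<and> 3 * t \<le> 2 * n \<and> 2 * s \<le> t \<and> 2 * t \<le> n + 2 * s)"
  shows "15 * (real n)\<^sup>2 + 72 < 76 * real (M_count (1/2) n s t)"
proof -
  define x y z where "x = real n" and "y = real s" and "z = real t"
  note xyz = x_def y_def z_def
  \<comment> \<open>Lets the surplus in x^2 absorb the constant 72 and the rounding losses of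
    1/4.\<close>
  have x: "24 * 24 \<le> x * x" using n by (intro mult_mono) (auto simp: xyz)
  have pos: "0 \<le> y" "y \<le> z" "z \<le> x" "0 \<le> x" using le by (auto simp: xyz)
  let ?M = "real (M_count (1/2) n s t)"
  note M = M_count_split[OF le]
  note nonneg = gap_sum_nonneg[of s t n] gap_sum_nonneg[of "n - t" t n] gap_sum_nonneg[of "n - t" 0 s]
    cross_sum_nonneg[of n s t 0 s] cross_sum_nonneg[of n s t t n]
  \<comment> \<open>The letters name the sums bounded by \<open>outer_sums_ge\<close>: A is
    \<open>gap_sum s 0 s\<close>, B is \<open>gap_sum (n - t) 0 s\<close>, E is
    \<open>gap_sum (t - s) s t\<close>.\<close>
  have AE: "y\<^sup>2 + (z - y)\<^sup>2 - z\<^sup>2 / 4 + gap_sum (n - t) 0 s \<le> ?M"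
    using outer_sums_ge(1)[OF le] M nonneg unfolding xyz by linarith
  have ABE: "7/4 * y\<^sup>2 + x * y - 3 * z * y + 3/4 * z\<^sup>2 + gap_sum (n - t) t n + cross_sum n s t t n \<le> ?M"
    using outer_sums_ge(2)[OF le] M nonneg unfolding xyz by linarith
  have tangent: "c * (2 * x - 4 * (z - y) - c) \<le> 4 * cross_sum n s t t n + 1"
    if "2 * s \<le> n" "n \<le> 2 * t" "0 \<le> c" "c \<le> x - z" for c
    using excess_sum_tangent[of t n c "t - s"] cross_sum_high[of s n t] that le
    by (simp add: xyz of_nat_diff)
  have high: "(x - z)\<^sup>2 - (x - z) * z + z\<^sup>2 / 4 - 1/4 \<le> gap_sum (n - t) t n"
    if "n \<le> 2 * t" "3 * t \<le> 2 * n"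
    using high_gap_sum[OF le(2) that] quarter_sq_bounds[of t] by (simp add: xyz)
  \<comment> \<open>In each case the listed nonnegative products and squares certify the bound, and
    the claim follows by linear arithmetic in the monomials. The cut 179/200 lies slightly above
    sqrt(15/19), beyond which the minimum z^2/4 of AE, at y = z/2, suffices.\<close>
  consider (a) "179 * n \<le> 200 * t" | (b1) "n \<le> 2 * s" "3 * n \<le> 4 * t" | (b2) "n \<le> 2 * s" "4 * t \<le> 3 * n"
    | (c) "2 * t \<le> n"
    | (d1) "2 * s \<le> n" "n \<le> 2 * t" "2 * n \<le> 3 * t" "20 * t \<le> 17 * n"
    | (d2) "2 * s \<le> n" "n \<le> 2 * t" "17 * n \<le> 20 * t" "200 * t \<le> 179 * n"
    | (e) "2 * s \<le> n" "n \<le> 2 * t" "3 * t \<le> 2 * n" "t \<le> 2 * s"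
    | (f) "2 * s \<le> n" "n \<le> 2 * t" "3 * t \<le> 2 * n" "n + 2 * s \<le> 2 * t"
    using outer linear[of "179 * n" "200 * t"] linear[of n "2 * s"] linear[of n "2 * t"]
      linear[of "3 * n" "4 * t"] linear[of "2 * n" "3 * t"] linear[of "17 * n" "20 * t"]
      linear[of t "2 * s"] linear[of "2 * t" "n + 2 * s"] by blast
  then have "15 * (x * x) + 72 < 76 * ?M"
  proof cases
    case a
    have "0 \<le> (200 * z - 179 * x) * (200 * z + 179 * x)"
      using a pos by (intro mult_nonneg_nonneg) (auto simp: xyz)
    moreover have "0 \<le> (2 * y - z)\<^sup>2" by simp
    ultimately show ?thesis using AE nonneg x
      by (simp add: power2_eq_square algebra_simps)
  next
    case b1
    have "gap_sum (n - t) 0 s = gap_sum (n - t) 0 (2 * (n - t))"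
      using b1 le by (intro gap_sum_cut) auto
    also have "\<dots> = (x - z)\<^sup>2"
      using le by (subst gap_sum_eq) (auto simp: quarter_sq_even quarter_sq_def[of 0] of_nat_diff power2_eq_square xyz)
    finally have "gap_sum (n - t) 0 s = (x - z)\<^sup>2" .
    moreover have "0 \<le> (2 * y - x) * (x - z)"
      using b1 pos by (intro mult_nonneg_nonneg) (auto simp: xyz)
    \<comment> \<open>The bound increases in y for y \<ge> z/2, so y = x/2 is extremal; there its
      minimum in z is at z = 6/7 x.\<close>
    moreover have "0 \<le> (2 * y - x)\<^sup>2" "0 \<le> (7 * z - 6 * x)\<^sup>2" by simp_all
    ultimately show ?thesis using AE x
      by (simp add: power2_eq_square algebra_simps)
  next
    case b2
    have "0 \<le> (2 * y - x) * (3 * x - 4 * z)" "0 \<le> (2 * y - x) * x"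
      "0 \<le> (3 * x - 4 * z) * (5 * x - 4 * z)"
      using b2 pos by (intro mult_nonneg_nonneg; auto simp: xyz)+
    moreover have "0 \<le> (2 * y - x)\<^sup>2" by simp
    ultimately show ?thesis using ABE nonneg x
      by (simp add: power2_eq_square algebra_simps)
  next
    case c
    have "(x - z)\<^sup>2 - (quarter_sq n - quarter_sq t) \<le> gap_sum (n - t) t n"
      using gap_sum_ge[OF le(2), of "n - t"] le by (simp add: of_nat_diff power2_eq_square xyz)
    then have "(x - z)\<^sup>2 - x\<^sup>2 / 4 + z\<^sup>2 / 4 - 1/4 \<le> gap_sum (n - t) t n"
      using quarter_sq_bounds[of n] quarter_sq_bounds[of t] by (simp add: xyz)
    \<comment> \<open>Up to rounding, minimizing over y, at the zero of 7 y - 6 z + 2 x, leaves (6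
      x^2 + (x - 2 z) (11 x - 10 z)) / 28.\<close>
    moreover have "0 \<le> (x - 2 * z) * (11 * x - 10 * z)"
      using c pos by (intro mult_nonneg_nonneg) (auto simp: xyz)
    moreover have "0 \<le> (7 * y - 6 * z + 2 * x)\<^sup>2" by simp
    ultimately show ?thesis using ABE nonneg x
      by (simp add: power2_eq_square algebra_simps)
  next
    case d1
    \<comment> \<open>After minimizing over y the bound is concave in z, so the endpoints of the
      z-interval decide; the first product removes the z^2 term. The choice c = 3/20 x is the
      largest with c \<le> x - z on the whole interval.\<close>
    have "0 \<le> (3 * z - 2 * x) * (17 * x - 20 * z)" "0 \<le> (3 * z - 2 * x) * x" "0 \<le> (17 * x - 20 * z) * x"
      using d1 pos by (intro mult_nonneg_nonneg; auto simp: xyz)+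
    moreover have "0 \<le> (7 * y - 6 * z + 2 * x + 2 * (3/20 * x))\<^sup>2" by simp
    moreover have "3/20 * x * (2 * x - 4 * (z - y) - 3/20 * x) \<le> 4 * cross_sum n s t t n + 1"
      using d1 by (intro tangent) (auto simp: xyz)
    ultimately show ?thesis using ABE nonneg x
      by (simp add: power2_eq_square algebra_simps)
  next
    case d2
    \<comment> \<open>Same argument as before; c = x/10 is admissible because x - z \<ge> 21/200
      x.\<close>
    have "0 \<le> (20 * z - 17 * x) * (179 * x - 200 * z)" "0 \<le> (20 * z - 17 * x) * x" "0 \<le> (179 * x - 200 * z) * x"
      using d2 pos by (intro mult_nonneg_nonneg; auto simp: xyz)+
    moreover have "0 \<le> (7 * y - 6 * z + 2 * x + 2 * (1/10 * x))\<^sup>2" by simp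
    moreover have "1/10 * x * (2 * x - 4 * (z - y) - 1/10 * x) \<le> 4 * cross_sum n s t t n + 1"
      using d2 by (intro tangent) (auto simp: xyz)
    ultimately show ?thesis using ABE nonneg x
      by (simp add: power2_eq_square algebra_simps)
  next
    case e
    have "0 \<le> (2 * y - z) * x"
      using e pos by (intro mult_nonneg_nonneg) (auto simp: xyz)
    moreover have "0 \<le> (76 * y - 25 * x)\<^sup>2" "0 \<le> (2 * z - y - x)\<^sup>2" by simp_all
    \<comment> \<open>The value 3/19 x is that of n - 2 (t - s) at the minimizer s = 4/19 n, t =
      12/19 n of the central quadratic form.\<close>
    moreover have "3/19 * x * (2 * x - 4 * (z - y) - 3/19 * x) \<le> 4 * cross_sum n s t t n + 1"
      using e by (intro tangent) (auto simp: xyz)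
    ultimately show ?thesis using ABE high e x
      by (simp add: power2_eq_square algebra_simps)
  next
    case f
    have "0 \<le> (2 * z - 2 * y - x) * x"
      using f pos by (intro mult_nonneg_nonneg) (auto simp: xyz)
    \<comment> \<open>The last cross sum vanishes here, since y div 2 \<le> t - s. Both squares are
      zero at the central minimizer (4/19 x, 12/19 x).\<close>
    moreover have "0 \<le> (19 * y - 4 * x)\<^sup>2" "0 \<le> (38 * z - 19 * y - 20 * x)\<^sup>2" by simp_all
    ultimately show ?thesis using ABE high f nonneg x
      by (simp add: power2_eq_square algebra_simps)
  qed
  then show ?thesis by (simp add: xyz power2_eq_square)
qed

section \<open>Reduction modulo 38\<close>

definition target :: "int \<Rightarrow> int" where
  "target n = (15 * n^2 + 72) div 76 +
     (if n mod 38 = 18 \<or> n mod 38 = 20 then 1 else if n mod 38 = 19 then -1 else 0)"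

definition central :: "int \<Rightarrow> int \<Rightarrow> int \<Rightarrow> int" where
  "central n s t = 11 * s\<^sup>2 + 8 * n * s - 20 * t * s + 16 * t\<^sup>2
      - 16 * n * t + 5 * n\<^sup>2 - n mod 2 + s mod 2"

text \<open>As 15 * 38^2 = 76 * 285 and 2 * 15 * 38 = 76 * 15, the added terms are multiples of 76
  and leave the division exactly.\<close>

lemma target_shift: "target (38 * q + r) = 285 * q\<^sup>2 + 15 * q * r + target r"
proof -
  have "15 * (38 * q + r)\<^sup>2 + 72 = (15 * r\<^sup>2 + 72) + 76 * (285 * q\<^sup>2 + 15 * q * r)"
    by (simp add: power2_eq_square algebra_simps)
  then have "(15 * (38 * q + r)\<^sup>2 + 72) div 76 = 285 * q\<^sup>2 + 15 * q * r + (15 * r\<^sup>2 + 72) div 76"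
    by simp
  then show ?thesis by (simp add: target_def)
qed

text \<open>The vector (38, 8, 24) points along the ray s = 4/19 n, t = 12/19 n of real minimizers,
  so terms in q a and q b cancel. Using twice (19, 4, 12) preserves the parities of n and s.\<close>

lemma central_shift:
  "central (38 * q + r) (8 * q + a) (24 * q + b) = 4 * (285 * q\<^sup>2 + 15 * q * r) + central r a b"
proof -
  have "(38 * q + r) mod 2 = r mod 2" "(8 * q + a) mod 2 = a mod 2"
    by presburger+
  then show ?thesis
    unfolding central_def by (simp add: power2_eq_square algebra_simps)
qed

text \<open>Completing the square first in t, then in s.\<close>

lemma central_squares:
  "76 * central n s t = 19 * (8 * t - 5 * s - 4 * n)\<^sup>2 + (19 * s - 4 * n)\<^sup>2 + 60 * n\<^sup>2
     - 76 * (n mod 2) + 76 * (s mod 2)"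
  unfolding central_def by (simp add: power2_eq_square algebra_simps)

text \<open>The ranges cover |19 a - 4 r| \<le> 25 and |8 b - 5 a - 4 r| \<le> 5, which
  \<open>central_ge_residue\<close> derives for any counterexample.\<close>

lemma central_check:
  "\<forall>r\<in>set [0..37]. \<forall>a\<in>set [(4 * r - 25) div 19..(4 * r + 25) div 19].
     \<forall>b\<in>set [(5 * a + 4 * r - 5) div 8..(5 * a + 4 * r + 5) div 8]. 4 * target r \<le> central r a b"
  by code_simp

text \<open>For r in {0, 1, 2, 4} no pair with a \<ge> 1 in the central region attains the target.
  There the inequalities are relaxed by 8, 10, 4, 8, 6, the slack that the shift by (38, 8, 24)
  gains for each unit of q.\<close>

lemma central_attained_check:
  "\<forall>r\<in>set [0..37].
     \<exists>a\<in>set [(4 * r - 25) div 19..(4 * r + 25) div 19].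
     \<exists>b\<in>set [(5 * a + 4 * r - 5) div 8..(5 * a + 4 * r + 5) div 8].
       central r a b = 4 * target r \<and>
       (if r \<in> {0, 1, 2, 4}
        then -7 \<le> a \<and> r \<le> 2 * b + 10 \<and> 3 * b \<le> 2 * r + 4 \<and> 2 * a \<le> b + 8 \<and> 2 * b \<le> r + 2 * a + 6
        else 1 \<le> a \<and> r \<le> 2 * b \<and> 3 * b \<le> 2 * r \<and> 2 * a \<le> b \<and> 2 * b \<le> r + 2 * a)"
  by code_simp

text \<open>Integer copy of \<^const>\<open>row_count\<close>: evaluation by code equations is unary on nat.\<close>
definition row_count_int :: "int \<Rightarrow> int \<Rightarrow> int \<Rightarrow> int \<Rightarrow> int" where
  "row_count_int n s t y = (let h = y div 2 in
     if y \<le> s \<or> t < y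
     then max 0 (s - h) + max 0 (n - t - h) + max 0 (min s (n - h) - max 0 (t - h))
     else max 0 (t - s - h))"

section \<open>Integer evaluation of small cases\<close>

lemma M_count_row_count_int:
  assumes "s \<le> t" "t \<le> n"
  shows "int (M_count (1/2) n s t) = sum_list (map (row_count_int (int n) (int s) (int t)) [1..int n])"
proof -
  have "int (s - h) = max 0 (int s - int h)" "int (n - t - h) = max 0 (int n - int t - int h)"
    "int (min s (n - h) - (t - h)) = max 0 (min (int s) (int n - int h) - max 0 (int t - int h))"
    "int (t - s - h) = max 0 (int t - int s - int h)" for h
    using assms by linarith+
  then have row: "int (row_count n s t y) = row_count_int (int n) (int s) (int t) (int y)" for y
    using zdiv_int[of y 2] by (simp add: row_count_def row_count_int_def Let_def)
  have "int ` {0<..n} = {1..int n}"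
    using image_int_atLeastAtMost[of 1 n] by (simp add: atLeastSucAtMost_greaterThanAtMost)
  then have "sum_list (map (row_count_int (int n) (int s) (int t)) [1..int n])
      = (\<Sum>y\<in>int ` {0<..n}. row_count_int (int n) (int s) (int t) y)"
    by (simp add: sum_list_distinct_conv_sum_set)
  also have "\<dots> = (\<Sum>y\<in>{0<..n}. int (row_count n s t y))"
    by (subst sum.reindex) (auto simp: row)
  finally show ?thesis
    using assms by (simp add: M_count_rows)
qed

text \<open>Covers all n below the threshold 24 of \<open>M_count_outer\<close>.\<close>

lemma small_values_check:
  "\<forall>n\<in>set [1..23]. \<forall>s\<in>set [1..n]. \<forall>t\<in>set [s..n].
     target n \<le> sum_list (map (row_count_int n s t) [1..n])"
  by code_simp

text \<open>These n are the positive exceptional residues with q = 0, where the relaxed inequalities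
  do not reach the central region.\<close>

lemma tiny_values_check:
  "sum_list (map (row_count_int 1 1 1) [1..1]) = target 1 \<and> sum_list (map (row_count_int 2 1 2) [1..2]) = target 2
    \<and> sum_list (map (row_count_int 4 1 3) [1..4]) = target 4"
  by code_simp

section \<open>The lower bound for the quadratic form over all integers\<close>

lemma central_ge_residue:
  assumes "0 \<le> r" "r < 38"
  shows "4 * target r \<le> central r a b"
proof (rule ccontr)
  assume neg: "\<not> ?thesis"
  then have "76 * central r a b < 304 * target r" by linarith
  \<comment> \<open>592 = 4 * (72 + 76), where 76 accounts for the correction of at most 1.\<close>
  moreover have "304 * target r \<le> 60 * r\<^sup>2 + 592"
    using pos_mod_sign[of 76 "15 * r\<^sup>2 + 72"] mult_div_mod_eq[of 76 "15 * r\<^sup>2 + 72"]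
    unfolding target_def by auto
  moreover have "0 \<le> a mod 2" "r mod 2 \<le> 1" by simp_all
  \<comment> \<open>668 = 592 + 76, the last term from r mod 2 \<le> 1. It is less than 26^2 = 676
    and 19 * 6^2 = 684.\<close>
  ultimately have *: "19 * (8 * b - 5 * a - 4 * r)\<^sup>2 + (19 * a - 4 * r)\<^sup>2 < 668"
    unfolding central_squares by linarith
  then have "(19 * a - 4 * r)\<^sup>2 < 26\<^sup>2" "(8 * b - 5 * a - 4 * r)\<^sup>2 < 6\<^sup>2"
    using zero_le_power2[of "19 * a - 4 * r"] zero_le_power2[of "8 * b - 5 * a - 4 * r"]
    unfolding power2_eq_square[of "26::int"] power2_eq_square[of "6::int"] by linarith+
  then have "\<bar>19 * a - 4 * r\<bar> < 26" "\<bar>8 * b - 5 * a - 4 * r\<bar> < 6"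
    using power2_less_imp_less[of "\<bar>19 * a - 4 * r\<bar>" 26]
      power2_less_imp_less[of "\<bar>8 * b - 5 * a - 4 * r\<bar>" 6] by simp_all
  then have "a \<in> set [(4 * r - 25) div 19..(4 * r + 25) div 19]"
    "b \<in> set [(5 * a + 4 * r - 5) div 8..(5 * a + 4 * r + 5) div 8]" "r \<in> set [0..37]"
    using assms unfolding set_upto atLeastAtMost_iff by linarith+
  then show False using central_check neg by blast
qed

lemma central_ge: "4 * target n \<le> central n s t"
proof -
  define q r a b where "q = n div 38" and "r = n mod 38" and "a = s - 8 * q" and "b = t - 24 * q"
  have "n = 38 * q + r" "s = 8 * q + a" "t = 24 * q + b"
    by (simp_all add: q_def r_def a_def b_def)
  moreover have "4 * target r \<le> central r a b"
    by (rule central_ge_residue) (simp_all add: r_def)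
  ultimately show ?thesis
    using target_shift[of q r] central_shift[of q r a b] by simp
qed

section \<open>Lower bound and attainment for the count\<close>

lemma M_count_ge:
  assumes "1 \<le> s" "s \<le> t" "t \<le> n"
  shows "target (int n) \<le> int (M_count (1/2) n s t)"
proof -
  consider "n < 24" | "n \<le> 2 * t" "3 * t \<le> 2 * n" "2 * s \<le> t" "2 * t \<le> n + 2 * s"
    | "24 \<le> n" "\<not> (n \<le> 2 * t \<and> 3 * t \<le> 2 * n \<and> 2 * s \<le> t \<and> 2 * t \<le> n + 2 * s)"
    by (meson not_le)
  then show ?thesis
  proof cases
    case 1
    then have "int n \<in> set [1..23]" "int s \<in> set [1..int n]" "int t \<in> set [int s..int n]"
      using assms by simp_all
    then have "target (int n) \<le> sum_list (map (row_count_int (int n) (int s) (int t)) [1..int n])"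
      using small_values_check by blast
    then show ?thesis
      unfolding M_count_row_count_int[OF assms(2,3)] .
  next
    case 2
    then show ?thesis
      using M_count_central[OF 2] central_ge[of "int n" "int s" "int t"] by (simp add: central_def)
  next
    case 3
    have "real_of_int (15 * (int n)\<^sup>2 + 72) < real_of_int (76 * int (M_count (1/2) n s t))"
      using M_count_outer[OF assms(2,3) 3] by simp
    then have "15 * (int n)\<^sup>2 + 72 < 76 * int (M_count (1/2) n s t)"
      by (simp only: of_int_less_iff)
    \<comment> \<open>The strict inequality leaves room for the correction +1 in
      \<open>target\<close>.\<close>
    then have "(15 * (int n)\<^sup>2 + 72) div 76 < int (M_count (1/2) n s t)"
      by linarith
    then show ?thesis by (simp add: target_def)
  qed
qed

lemma M_count_attained:
  assumes "1 \<le> n"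
  obtains s t where "1 \<le> s" "s \<le> t" "t \<le> n" "int (M_count (1/2) n s t) = target (int n)"
proof (cases "n \<in> {1, 2, 4}")
  case True
  have "int (M_count (1/2) 1 1 1) = target 1" "int (M_count (1/2) 2 1 2) = target 2"
    "int (M_count (1/2) 4 1 3) = target 4"
    by (subst M_count_row_count_int; simp only: tiny_values_check of_nat_1 of_nat_numeral; simp)+
  then show ?thesis
    using True that[of 1 1] that[of 1 2] that[of 1 3] by fastforce
next
  case False
  define q r where "q = int n div 38" and "r = int n mod 38"
  have n: "int n = 38 * q + r" "0 \<le> q" "0 \<le> r" "r < 38" by (simp_all add: q_def r_def)
  then have "r \<in> set [0..37]" by simp
  then obtain a b where eq: "central r a b = 4 * target r"
    and bounds: "if r \<in> {0, 1, 2, 4}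
        then -7 \<le> a \<and> r \<le> 2 * b + 10 \<and> 3 * b \<le> 2 * r + 4 \<and> 2 * a \<le> b + 8 \<and> 2 * b \<le> r + 2 * a + 6
        else 1 \<le> a \<and> r \<le> 2 * b \<and> 3 * b \<le> 2 * r \<and> 2 * a \<le> b \<and> 2 * b \<le> r + 2 * a"
    using central_attained_check by blast
  define s t where "s = nat (8 * q + a)" and "t = nat (24 * q + b)"
  \<comment> \<open>With q = 0, n itself would be 0, 1, 2 or 4, all excluded in this case.\<close>
  have "0 < q" if "r \<in> {0, 1, 2, 4}"
  proof (rule ccontr)
    assume "\<not> 0 < q"
    then have "int n = r" using n by simp
    then show False using that False assms by auto
  qed
  note q_pos = this
  have ineqs: "1 \<le> 8 * q + a \<and> int n \<le> 2 * (24 * q + b) \<and> 3 * (24 * q + b) \<le> 2 * int n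
    \<and> 2 * (8 * q + a) \<le> 24 * q + b \<and> 2 * (24 * q + b) \<le> int n + 2 * (8 * q + a)"
  proof (cases "r \<in> {0, 1, 2, 4}")
    case True
    have "-7 \<le> a" "r \<le> 2 * b + 10" "3 * b \<le> 2 * r + 4" "2 * a \<le> b + 8" "2 * b \<le> r + 2 * a + 6"
      using bounds unfolding if_P[OF True] by blast+
    with n(1) q_pos[OF True] have "1 \<le> 8 * q + a" "int n \<le> 2 * (24 * q + b)" "3 * (24 * q + b) \<le> 2 * int n"
      "2 * (8 * q + a) \<le> 24 * q + b" "2 * (24 * q + b) \<le> int n + 2 * (8 * q + a)"
      unfolding distrib_left by linarith+
    then show ?thesis by blast
  next
    case False
    have "1 \<le> a" "r \<le> 2 * b" "3 * b \<le> 2 * r" "2 * a \<le> b" "2 * b \<le> r + 2 * a"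
      using bounds unfolding if_not_P[OF False] by blast+
    with n(1,2) have "1 \<le> 8 * q + a" "int n \<le> 2 * (24 * q + b)" "3 * (24 * q + b) \<le> 2 * int n"
      "2 * (8 * q + a) \<le> 24 * q + b" "2 * (24 * q + b) \<le> int n + 2 * (8 * q + a)"
      unfolding distrib_left by linarith+
    then show ?thesis by blast
  qed
  then have st: "int s = 8 * q + a" "int t = 24 * q + b" by (simp_all add: s_def t_def)
  have nat_ineqs: "n \<le> 2 * t" "3 * t \<le> 2 * n" "2 * s \<le> t" "2 * t \<le> n + 2 * s" "1 \<le> s"
    using ineqs unfolding st[symmetric] by linarith+
  have "4 * int (M_count (1/2) n s t) = central (int n) (int s) (int t)"
    using M_count_central[OF nat_ineqs(1-4)] by (simp add: central_def)
  also have "\<dots> = 4 * target (int n)"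
    unfolding st n(1) central_shift target_shift eq by simp
  finally have "int (M_count (1/2) n s t) = target (int n)" by simp
  then show ?thesis using that[of s t] nat_ineqs by linarith
qed

theorem theorem4p5:
  fixes n :: nat
  assumes "n \<ge> 1"
  shows "int (Min {M_count (1/2) n s t | s t. 1 \<le> s \<and> s \<le> t \<and> t \<le> n}) =
           (15 * int n ^ 2 + 72) div 76 +
           (if n mod 38 = 18 \<or> n mod 38 = 20 then 1
            else if n mod 38 = 19 then -1 else 0)"
proof -
  let ?S = "{M_count (1/2) n s t | s t. 1 \<le> s \<and> s \<le> t \<and> t \<le> n}"
  obtain s t where st: "1 \<le> s" "s \<le> t" "t \<le> n" and attained: "int (M_count (1/2) n s t) = target (int n)"
    using M_count_attained[OF assms] .
  have "?S \<subseteq> (\<lambda>(s, t). M_count (1/2) n s t) ` ({..n} \<times> {..n})"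
  proof
    fix m assume "m \<in> ?S"
    then obtain s' t' where "m = M_count (1/2) n s' t'" "s' \<le> t'" "t' \<le> n"
      by blast
    then show "m \<in> (\<lambda>(s, t). M_count (1/2) n s t) ` ({..n} \<times> {..n})"
      by (intro image_eqI[of _ _ "(s', t')"]) simp_all
  qed
  then have "finite ?S" by (rule finite_subset) simp
  moreover have "M_count (1/2) n s t \<le> m" if "m \<in> ?S" for m
  proof -
    obtain s' t' where "m = M_count (1/2) n s' t'" "1 \<le> s'" "s' \<le> t'" "t' \<le> n"
      using \<open>m \<in> ?S\<close> by blast
    then have "int (M_count (1/2) n s t) \<le> int m"
      using attained M_count_ge[of s' t' n] by simp
    then show ?thesis by simp
  qed
  moreover have "M_count (1/2) n s t \<in> ?S" using st by blast
  ultimately have "Min ?S = M_count (1/2) n s t" by (intro Min_eqI)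
  moreover have "int n mod 38 = int (n mod 38)"
    by (simp add: zmod_int)
  then have "int n mod 38 = 18 \<longleftrightarrow> n mod 38 = 18" "int n mod 38 = 19 \<longleftrightarrow> n mod 38 = 19"
    "int n mod 38 = 20 \<longleftrightarrow> n mod 38 = 20"
    by (simp_all only:) simp_all
  ultimately show ?thesis using attained by (simp add: target_def)
qed

end
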